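(* For online bin packing under the random-order model, the random-order ratio of Best-Fit satisfies $RR^\infty_{\mathrm{BF}}>1.144$.
   Context: Bin packing: an instance is a list $I=(x_1,\dots,x_n)$ of items with sizes in $(0,1]$, to be partitioned into the minimum number $\mathrm{Opt}(I)$ of unit-capacity bins (total size in each bin at most $1$). Best-Fit (BF) processes items in the given order and places each item into the fullest already-opened bin in which it fits, opening a new bin only if it fits nowhere; $\mathrm{BF}(J)$ is the number of bins used on sequence $J$. For a permutation $\sigma$ of $[n]$, $I_\sigma=(x_{\sigma(1)},\dots,x_{\sigma(n)})$. The random-order ratio of an online algorithm $\mathcal A$ is $RR^\infty_{\mathcal A}=\limsup_{m\to\infty}\sup_{I:\mathrm{Opt}(I)=m}\mathbb{E}_\sigma[\mathcal A(I_\sigma)]/\mathrm{Opt}(I)$, where $\sigma$ is uniform over all permutations of $[n]$. *)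

theory Defs
  imports "HOL-Probability.Probability" "HOL-Combinatorics.Permutations"
    "HOL-Library.Multiset"
begin

definition bp_instance :: "real list \<Rightarrow> bool" where
  "bp_instance I \<longleftrightarrow> (\<forall>x \<in> set I. 0 < x \<and> x \<le> 1)"

text \<open>A packing assigns to every item position \<open>i\<close> the index \<open>f i\<close> of its bin.\<close>

definition is_packing :: "real list \<Rightarrow> nat \<Rightarrow> (nat \<Rightarrow> nat) \<Rightarrow> bool" where
  "is_packing I k f \<longleftrightarrow>
     (\<forall>i < length I. f i < k) \<and>
     (\<forall>b < k. (\<Sum>i | i < length I \<and> f i = b. I ! i) \<le> 1)"

definition bp_opt :: "real list \<Rightarrow> nat" where
  "bp_opt I = (LEAST k. \<exists>f. is_packing I k f)"

text \<open>The state of Best-Fit is the multiset of the loads of the opened bins. Bins of equal load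
  are interchangeable for all later decisions, so no tie-breaking rule is needed.\<close>

definition best_fit_step :: "real \<Rightarrow> real multiset \<Rightarrow> real multiset" where
  "best_fit_step x B =
     (let F = {b. b \<in># B \<and> b + x \<le> 1}
      in if F = {} then add_mset x B
         else add_mset (Max F + x) (B - {#Max F#}))"

definition best_fit :: "real list \<Rightarrow> nat" where
  "best_fit J = size (fold best_fit_step J {#})"

text \<open>An online algorithm enters only through the number of bins that it uses on each sequence.\<close>

definition random_order_cost :: "(real list \<Rightarrow> nat) \<Rightarrow> real list \<Rightarrow> real" where
  "random_order_cost \<A> I =
     measure_pmf.expectation (pmf_of_set {\<sigma>. \<sigma> permutes {..<length I}})
       (\<lambda>\<sigma>. real (\<A> (permute_list \<sigma> I)))"

definition random_order_ratio :: "(real list \<Rightarrow> nat) \<Rightarrow> ereal" where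
  "random_order_ratio \<A> =
     limsup (\<lambda>m. SUP I \<in> {I. bp_instance I \<and> bp_opt I = m}.
       ereal (random_order_cost \<A> I / real (bp_opt I)))"

end

theory Submission
  imports Defs
begin

text \<open>
  Take thirteen items that fill four bins exactly: in units of \<open>1/120\<close>, the bins \<open>30,30,30,30\<close>,
  \<open>31,31,58\<close>, \<open>33,33,54\<close> and \<open>37,37,46\<close>. Draw \<open>n\<close> items independently and uniformly from these
  thirteen. The distribution of such a sequence is invariant under permutations, so the expected
  cost of an algorithm is an average of random-order costs. The number of copies of each template
  item deviates from \<open>n/13\<close> by \<open>O(sqrt n)\<close>, so the expected optimum is at most \<open>4n/13 + O(sqrt n)\<close>.
  Under Best-Fit the bins that can still receive an item form a Markov chain. After identification
  of loads that admit the same further items it has 114 states, and its long-run rate of opened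
  bins exceeds \<open>1.144 \<cdot> 4/13\<close> per item. The rate is bounded from below by a potential on the states:
  in every state, the expected number of opened bins plus the expected increase of the potential is
  at least the claimed rate.
\<close>

section \<open>Best-Fit on integer sizes\<close>

lemma best_fit_step_opens: "\<forall>b\<in>#B. b + x > 1 \<Longrightarrow> best_fit_step x B = add_mset x B"
  by (auto simp: best_fit_step_def Let_def not_le[symmetric])

lemma best_fit_step_fits:
  assumes "m \<in># B" "m + x \<le> 1" "\<And>b. b \<in># B \<Longrightarrow> b + x \<le> 1 \<Longrightarrow> b \<le> m"
  shows "best_fit_step x B = add_mset (m + x) (B - {#m#})"
proof -
  have "Max {b. b \<in># B \<and> b + x \<le> 1} = m" using assms by (intro Max_eqI) auto
  moreover have "{b. b \<in># B \<and> b + x \<le> 1} \<noteq> {}" using assms by auto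
  ultimately show ?thesis by (simp only: best_fit_step_def Let_def if_False)
qed

lemma best_fit_cases:
  fixes x :: real
  obtains (opens) "\<forall>b\<in>#B. b + x > 1"
  | (fits) m where "m \<in># B" "m + x \<le> 1" "\<And>b. b \<in># B \<Longrightarrow> b + x \<le> 1 \<Longrightarrow> b \<le> m"
proof (cases "{b. b \<in># B \<and> b + x \<le> 1} = {}")
  case True
  then show ?thesis using opens by (auto simp: not_le)
next
  case False
  then show ?thesis
    using fits[of "Max {b. b \<in># B \<and> b + x \<le> 1}"] Max_in[OF _ False] by auto
qed

lemma size_best_fit_step: "size (best_fit_step x B) = size B + of_bool (\<forall>b\<in>#B. b + x > 1)"
proof (cases B x rule: best_fit_cases)
  case opens
  then show ?thesis by (simp add: best_fit_step_opens)
next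
  case (fits m)
  then have "\<not> (\<forall>b\<in>#B. b + x > 1)" by (auto simp: not_less)
  moreover have "size (best_fit_step x B) = size B"
    using fits by (simp add: best_fit_step_fits size_Suc_Diff1)
  ultimately show ?thesis by simp
qed

lemma best_fit_step_filter_mset:
  assumes "\<epsilon> \<le> x"
  shows "best_fit_step x B =
    best_fit_step x {#b \<in># B. b + \<epsilon> \<le> 1#} + {#b \<in># B. \<not> b + \<epsilon> \<le> 1#}"
    (is "_ = best_fit_step x ?open + ?full")
proof (cases B x rule: best_fit_cases)
  case opens
  then show ?thesis by (simp add: best_fit_step_opens flip: multiset_partition)
next
  case (fits m)
  then have m: "m \<in># ?open" using assms by simp
  have "B - {#m#} = (?open + ?full) - {#m#}" by (simp flip: multiset_partition)
  also have "\<dots> = ?open - {#m#} + ?full" using m by simp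
  finally show ?thesis
    using fits best_fit_step_fits[OF m] by (simp add: best_fit_step_fits)
qed

definition rel_size :: "int \<Rightarrow> int \<Rightarrow> real" where
  "rel_size C x = real_of_int x / real_of_int C"

lemma rel_size_add: "rel_size C (x + y) = rel_size C x + rel_size C y"
  by (simp add: rel_size_def add_divide_distrib)

lemma rel_size_mono: "C > 0 \<Longrightarrow> x \<le> y \<Longrightarrow> rel_size C x \<le> rel_size C y"
  by (simp add: rel_size_def divide_right_mono)

lemma rel_size_add_le_1_iff: "C > 0 \<Longrightarrow> rel_size C x + rel_size C y \<le> 1 \<longleftrightarrow> x + y \<le> C"
  by (simp add: rel_size_def field_simps flip: of_int_add)

lemma rel_size_add_gt_1_iff: "C > 0 \<Longrightarrow> 1 < rel_size C x + rel_size C y \<longleftrightarrow> C < x + y"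
  by (simp add: rel_size_def field_simps flip: of_int_add)

definition loads :: "int \<Rightarrow> int list \<Rightarrow> real multiset" where
  "loads C s = image_mset (rel_size C) (mset s)"

definition opens_bin :: "int \<Rightarrow> int \<Rightarrow> int list \<Rightarrow> bool" where
  "opens_bin C x s \<longleftrightarrow> (\<forall>l\<in>set s. l + x > C)"

text \<open>In a decreasing list of loads, the first bin that fits is the fullest one.\<close>

fun place :: "int \<Rightarrow> int \<Rightarrow> int list \<Rightarrow> int list" where
  "place C x [] = [x]"
| "place C x (l # s) = (if l + x \<le> C then (l + x) # s else l # place C x s)"

lemma mset_place_opens: "opens_bin C x s \<Longrightarrow> mset (place C x s) = add_mset x (mset s)"
  by (induction s) (auto simp: opens_bin_def)

lemma mset_place_fits:
  assumes "sorted_wrt (\<ge>) s" "\<not> opens_bin C x s"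
  obtains m where "m \<in> set s" "m + x \<le> C" "\<And>l. l \<in> set s \<Longrightarrow> l + x \<le> C \<Longrightarrow> l \<le> m"
    "mset (place C x s) = add_mset (m + x) (mset s - {#m#})"
  using assms
proof (induction s arbitrary: thesis)
  case Nil
  then show ?case by (simp add: opens_bin_def)
next
  case (Cons l s)
  show ?case
  proof (cases "l + x \<le> C")
    case True
    then show ?thesis using Cons.prems by (intro Cons.prems(1)[of l]) auto
  next
    case False
    then have "\<not> opens_bin C x s" "sorted_wrt (\<ge>) s" using Cons.prems by (auto simp: opens_bin_def)
    then obtain m where m: "m \<in> set s" "m + x \<le> C" "\<And>l. l \<in> set s \<Longrightarrow> l + x \<le> C \<Longrightarrow> l \<le> m"
      "mset (place C x s) = add_mset (m + x) (mset s - {#m#})"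
      using Cons.IH by blast
    with False show ?thesis by (intro Cons.prems(1)[of m]) auto
  qed
qed

lemma best_fit_step_loads:
  assumes C: "C > 0" and s: "sorted_wrt (\<ge>) s"
  shows "best_fit_step (rel_size C x) (loads C s) = loads C (place C x s)"
proof (cases "opens_bin C x s")
  case True
  then have "\<forall>b\<in>#loads C s. b + rel_size C x > 1"
    using C by (simp add: loads_def opens_bin_def rel_size_add_gt_1_iff)
  then show ?thesis
    using True by (simp add: best_fit_step_opens mset_place_opens loads_def)
next
  case False
  then obtain m where m: "m \<in> set s" "m + x \<le> C" "\<And>l. l \<in> set s \<Longrightarrow> l + x \<le> C \<Longrightarrow> l \<le> m"
    and mset: "mset (place C x s) = add_mset (m + x) (mset s - {#m#})"
    using mset_place_fits[OF s] by blast
  have "best_fit_step (rel_size C x) (loads C s) =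
      add_mset (rel_size C m + rel_size C x) (loads C s - {#rel_size C m#})"
    using C m
    by (intro best_fit_step_fits) (auto simp: loads_def rel_size_add_le_1_iff intro: rel_size_mono)
  also have "\<dots> = loads C (place C x s)"
    using m(1) by (simp add: loads_def mset image_mset_Diff rel_size_add)
  finally show ?thesis .
qed

text \<open>When all items have size at least \<open>k\<close>, the bins of load more than \<open>C - k\<close> are dropped from the
  state: they never receive another item.\<close>

definition next_state :: "int \<Rightarrow> int \<Rightarrow> int \<Rightarrow> int list \<Rightarrow> int list" where
  "next_state C k x s = rev (sort (filter (\<lambda>l. l + k \<le> C) (place C x s)))"

definition represents :: "int \<Rightarrow> int \<Rightarrow> int list \<Rightarrow> real multiset \<Rightarrow> bool" where
  "represents C k s B \<longleftrightarrow> sorted_wrt (\<ge>) s \<and>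
     loads C s = {#b \<in># B. b + rel_size C k \<le> 1#}"

lemma represents_best_fit_step:
  assumes C: "C > 0" and x: "k \<le> x" and rep: "represents C k s B"
  shows "represents C k (next_state C k x s) (best_fit_step (rel_size C x) B)"
proof -
  have s: "sorted_wrt (\<ge>) s" "loads C s = {#b \<in># B. b + rel_size C k \<le> 1#}"
    using rep by (simp_all add: represents_def)
  have "rel_size C k \<le> rel_size C x" using C x by (rule rel_size_mono)
  then have "best_fit_step (rel_size C x) B =
      loads C (place C x s) + {#b \<in># B. \<not> b + rel_size C k \<le> 1#}"
    using best_fit_step_filter_mset[of "rel_size C k" "rel_size C x" B]
      best_fit_step_loads[OF C s(1)]
    by (simp add: s(2))
  moreover have "{#b \<in># loads C (place C x s). b + rel_size C k \<le> 1#} = loads C (next_state C k x s)"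
    by (simp add: loads_def next_state_def filter_mset_image_mset rel_size_add_le_1_iff[OF C])
  moreover have "sorted_wrt (\<ge>) (next_state C k x s)"
    using sorted_sort by (simp add: next_state_def sorted_wrt_rev)
  ultimately show ?thesis by (simp add: represents_def)
qed

lemma size_best_fit_step_represents:
  assumes C: "C > 0" and x: "k \<le> x" and rep: "represents C k s B"
  shows "size (best_fit_step (rel_size C x) B) = size B + of_bool (opens_bin C x s)"
proof -
  have "rel_size C k \<le> rel_size C x" using C x by (rule rel_size_mono)
  then have "b + rel_size C k \<le> 1" if "\<not> b + rel_size C x > 1" for b
    using that by linarith
  then have "(\<forall>b\<in>#B. b + rel_size C x > 1) \<longleftrightarrow>
      (\<forall>b\<in>#{#b \<in># B. b + rel_size C k \<le> 1#}. b + rel_size C x > 1)"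
    by auto
  also have "\<dots> \<longleftrightarrow> (\<forall>b\<in>#loads C s. b + rel_size C x > 1)"
    using rep by (simp add: represents_def)
  also have "\<dots> \<longleftrightarrow> opens_bin C x s"
    using C by (simp add: loads_def opens_bin_def rel_size_add_gt_1_iff)
  finally show ?thesis by (simp add: size_best_fit_step)
qed

lemma represents_fold:
  assumes "C > 0" "\<And>x. x \<in> set xs \<Longrightarrow> k \<le> x"
  shows "represents C k (fold (next_state C k) xs [])
    (fold best_fit_step (map (rel_size C) xs) {#})"
  using assms(2)
proof (induction xs rule: rev_induct)
  case Nil
  then show ?case by (simp add: represents_def loads_def)
next
  case (snoc x xs)
  then show ?case by (simp add: represents_best_fit_step assms(1))
qed

definition load_rounding :: "int \<Rightarrow> int \<Rightarrow> int \<Rightarrow> (int \<Rightarrow> int) \<Rightarrow> bool" where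
  "load_rounding C k x r \<longleftrightarrow> mono r \<and>
     (\<forall>l. l \<le> r l \<and> r (r l) = r l \<and> (r l + k \<le> C \<longleftrightarrow> l + k \<le> C) \<and> (r l + x \<le> C \<longleftrightarrow> l + x \<le> C) \<and>
       (r l \<noteq> l \<longrightarrow> C < l + x + k))"

lemma map_sort_mono:
  fixes r :: "'a::linorder \<Rightarrow> 'b::linorder"
  assumes "mono r"
  shows "map r (sort xs) = sort (map r xs)"
proof (rule properties_for_sort[symmetric])
  show "sorted (map r (sort xs))"
    unfolding sorted_map by (rule sorted_wrt_mono_rel[OF _ sorted_sort]) (rule monoD[OF assms])
qed simp

text \<open>Rounding alters the load of a bin only if the next item that it receives fills it for good, so
  the rounded state determines its own successors.\<close>

lemma map_next_state_load_rounding: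
  assumes r: "load_rounding C k x r"
  shows "map r (next_state C k x (map r s)) = map r (next_state C k x s)"
proof -
  have "map r (filter (\<lambda>l. l + k \<le> C) (place C x (map r s))) =
      map r (filter (\<lambda>l. l + k \<le> C) (place C x s))"
  proof (induction s)
    case Nil
    then show ?case by simp
  next
    case (Cons l s)
    have tail: "map r (filter (\<lambda>l. l + k \<le> C) (map r s)) = map r (filter (\<lambda>l. l + k \<le> C) s)"
      using r by (induction s) (simp_all add: load_rounding_def)
    show ?case
    proof (cases "r l = l")
      case True
      then show ?thesis using r Cons.IH tail by (simp add: load_rounding_def)
    next
      case False
      then have "C < l + x + k" "C < r l + x + k"
        using r by (auto simp: load_rounding_def intro: less_le_trans)
      then show ?thesis using r Cons.IH tail by (simp add: load_rounding_def)
    qed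
  qed
  then show ?thesis
    using r by (simp add: next_state_def load_rounding_def map_sort_mono flip: rev_map)
qed

lemma opens_bin_load_rounding:
  "load_rounding C k x r \<Longrightarrow> opens_bin C x (map r s) \<longleftrightarrow> opens_bin C x s"
  by (simp add: load_rounding_def opens_bin_def flip: not_le)

section \<open>A template with a potential certificate\<close>

definition template :: "int list" where
  "template = [30, 30, 30, 30, 31, 31, 58, 33, 33, 54, 37, 37, 46]"

lemma template_packing:
  "is_packing (map (rel_size 120) template) 4
    (\<lambda>i. if i < 4 then 0 else Suc ((i - 4) div 3))"
    (is "is_packing ?items 4 ?bin")
proof -
  have len: "length ?items = 13" by (simp add: template_def)
  have "(\<Sum>i | i < 13 \<and> ?bin i = b. ?items ! i) \<le> 1" if "b < 4" for b
  proof -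
    have "(\<Sum>i | i < 13 \<and> ?bin i = b. ?items ! i) = (\<Sum>i<13. if ?bin i = b then ?items ! i else 0)"
      by (simp add: sum.inter_filter[symmetric])
    moreover have "b \<in> {0, 1, 2, 3}" using that by auto
    ultimately show ?thesis
      by (elim insertE emptyE)
        (simp_all add: lessThan_nat_numeral template_def rel_size_def del: sum.lessThan_Suc)
  qed
  then show ?thesis
    unfolding is_packing_def len by auto
qed

text \<open>A bin of load more than 60 receives at most one more item, so its load only matters through
  the largest item that still fits.\<close>

definition raise_load :: "int \<Rightarrow> int" where
  "raise_load l =
     (if l \<le> 60 then l else if l \<le> 62 then 62 else if l \<le> 66 then 66 else if l \<le> 74 then 74
      else if l \<le> 83 then 83 else if l \<le> 87 then 87 else if l \<le> 89 then 89 else l)"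

lemma load_rounding_raise_load:
  assumes "x \<in> set template"
  shows "load_rounding 120 30 x raise_load"
proof -
  have "mono raise_load" by (rule monoI) (simp add: raise_load_def)
  moreover have "x \<in> {30, 31, 33, 37, 46, 54, 58}" using assms by (auto simp: template_def)
  ultimately show ?thesis
    by (elim insertE emptyE) (simp_all add: load_rounding_def raise_load_def)
qed

text \<open>The reachable rounded states with the relative value function of the chain, computed numerically
  by value iteration, multiplied by 4400 and rounded to integers.\<close>

definition potential_table :: "(int list \<times> int) list" where
  "potential_table = [
    ([], 0), ([30], -3144), ([31], -3022), ([33], -2896), ([37], -2762), ([46], -2616),
    ([54], -2359), ([58], -2143), ([60], -1947), ([62], -1549), ([66], -1491), ([66,58], -3642),
    ([74], -1438), ([74,54], -3767), ([74,58], -3584), ([83], -1387), ([83,46], -3882),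
    ([83,54], -3684), ([83,58], -3518), ([87], -1316), ([87,37], -4099), ([87,46], -3886),
    ([87,54], -3508), ([87,58], -3374), ([87,74], -2837), ([87,74,54], -5114),
    ([87,74,58], -4970), ([87,83], -2746), ([87,83,46], -5170), ([87,83,54], -4990),
    ([87,83,58], -4867), ([89], -1286), ([89,33], -4267), ([89,37], -4092), ([89,46], -3890),
    ([89,54], -3535), ([89,58], -3231), ([89,66], -2873), ([89,66,58], -4943), ([89,74], -2797),
    ([89,74,54], -5078), ([89,74,58], -4877), ([89,83], -2718), ([89,83,46], -5165),
    ([89,83,54], -4965), ([89,83,58], -4794), ([89,87], -2613), ([89,87,37], -5432),
    ([89,87,46], -5172), ([89,87,54], -4717), ([89,87,58], -4609), ([89,87,74], -4194),
    ([89,87,74,54], -6425), ([89,87,74,58], -6302), ([89,87,83], -4078), ([89,87,83,46], -6467),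
    ([89,87,83,54], -6283), ([89,87,83,58], -6184), ([90], -1292), ([90,31], -4400),
    ([90,33], -4250), ([90,37], -4086), ([90,46], -3900), ([90,54], -3575), ([90,58], -3301),
    ([90,62], -2920), ([90,66], -2843), ([90,66,58], -4920), ([90,74], -2773),
    ([90,74,54], -5060), ([90,74,58], -4856), ([90,83], -2703), ([90,83,46], -5168),
    ([90,83,54], -4957), ([90,83,58], -4779), ([90,87], -2611), ([90,87,37], -5425),
    ([90,87,46], -5173), ([90,87,54], -4733), ([90,87,58], -4607), ([90,87,74], -4178),
    ([90,87,74,54], -6415), ([90,87,74,58], -6279), ([90,87,83], -4067), ([90,87,83,46], -6465),
    ([90,87,83,54], -6277), ([90,87,83,58], -6165), ([90,89], -2576), ([90,89,33], -5603),
    ([90,89,37], -5408), ([90,89,46], -5178), ([90,89,54], -4779), ([90,89,58], -4438),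
    ([90,89,66], -4198), ([90,89,66,58], -6199), ([90,89,74], -4112), ([90,89,74,54], -6361),
    ([90,89,74,58], -6137), ([90,89,83], -4021), ([90,89,83,46], -6455), ([90,89,83,54], -6238),
    ([90,89,83,58], -6053), ([90,89,87], -3905), ([90,89,87,37], -6752), ([90,89,87,46], -6463),
    ([90,89,87,54], -5966), ([90,89,87,58], -5861), ([90,89,87,74], -5518),
    ([90,89,87,74,54], -7717), ([90,89,87,74,58], -7600), ([90,89,87,83], -5389),
    ([90,89,87,83,46], -7765), ([90,89,87,83,54], -7569), ([90,89,87,83,58], -7477)]"

definition potential :: "int list \<Rightarrow> int" where
  "potential s = the (map_of potential_table s)"

lemma potential_table_row:
  "s \<in> dom (map_of potential_table) \<Longrightarrow> (s, potential s) \<in> set potential_table"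
  by (auto simp: potential_def map_of_SomeD)

lemma map_of_potential_table:
  "list_all (\<lambda>(s, v). map_of potential_table s = Some v) potential_table"
proof -
  have "distinct (map fst potential_table)"
    unfolding potential_table_def by simp
  then show ?thesis by (auto simp: list_all_iff)
qed

text \<open>Unfolds only the outer occurrence of the table, so that each row becomes a rewrite rule.\<close>

lemmas potential_table_lookup =
  map_of_potential_table
    [unfolded potential_table_def[THEN arg_cong[where f = "list_all P" for P]], simplified]

lemma Nil_in_potential_table: "[] \<in> dom (map_of potential_table)"
  by (simp add: potential_table_lookup dom_def)

text \<open>Used alone, these rules evaluate a transition several times faster than the full simpset.\<close>

lemmas transition_evaluation =
  next_state_def place.simps opens_bin_def raise_load_def filter.simps sort_key_simps
  insort_key.simps id_apply rev.simps append.simps list.map list.set Set.ball_simps(5,7) simp_thms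
  if_True if_False arith_simps rel_simps list.pred_inject prod.case

lemma raised_next_state_in_potential_table:
  assumes "s \<in> dom (map_of potential_table)" "x \<in> set template"
  shows "map raise_load (next_state 120 30 x s) \<in> dom (map_of potential_table)"
proof -
  have "list_all (\<lambda>(s, v). list_all (\<lambda>x.
      \<exists>u. map_of potential_table (map raise_load (next_state 120 30 x s)) = Some u)
      [30, 31, 33, 37, 46, 54, 58]) potential_table"
    by (subst potential_table_def)
      (simp only: potential_table_lookup transition_evaluation option.inject)
  then show ?thesis
    using potential_table_row[OF assms(1)] assms(2) by (fastforce simp: list_all_iff template_def)
qed

text \<open>The rate 4027/11440 per item is 20135/4400 per thirteen items.\<close>

lemma potential_drift:
  assumes "s \<in> dom (map_of potential_table)"
  shows "length template * (potential s / 4400 + 4027 / 11440) \<le>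
    (\<Sum>x\<leftarrow>template. potential (map raise_load (next_state 120 30 x s)) / 4400 +
      of_bool (opens_bin 120 x s))"
proof -
  define gain where
    "gain s x = potential (map raise_load (next_state 120 30 x s)) +
      4400 * of_bool (opens_bin 120 x s)" for s x
  have "list_all (\<lambda>(s, v). 13 * v + 20135 \<le>
      4 * gain s 30 + 2 * gain s 31 + 2 * gain s 33 + 2 * gain s 37 +
      gain s 46 + gain s 54 + gain s 58) potential_table"
    by (subst potential_table_def)
      (simp only: potential_table_lookup transition_evaluation gain_def potential_def option.sel
        of_bool_eq mult_1_right mult_zero_right)
  then have "13 * potential s + 20135 \<le> (\<Sum>x\<leftarrow>template. gain s x)"
    using potential_table_row[OF assms] by (auto simp: list_all_iff template_def)
  then have "real_of_int (13 * potential s + 20135) \<le> real_of_int (\<Sum>x\<leftarrow>template. gain s x)"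
    by (simp only: of_int_le_iff)
  moreover have "real_of_int (gain s x) =
      4400 * (potential (map raise_load (next_state 120 30 x s)) / 4400 +
        of_bool (opens_bin 120 x s))" for x
    by (simp add: gain_def)
  ultimately show ?thesis
    by (simp add: template_def)
qed

section \<open>Sequences of independent items\<close>

lemma finite_set_replicate_pmf:
  "finite (set_pmf p) \<Longrightarrow> finite (set_pmf (replicate_pmf n p))"
  unfolding set_replicate_pmf lists_eq_set by (simp add: finite_lists_length_eq)

lemma map_replicate_pmf: "replicate_pmf n (map_pmf f p) = map_pmf (map f) (replicate_pmf n p)"
  by (induction n) (simp_all add: map_bind_pmf bind_map_pmf)

lemma pmf_replicate_pmf:
  "pmf (replicate_pmf n p) xs = (if length xs = n then \<Prod>x\<in>#mset xs. pmf p x else 0)"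
proof (induction n arbitrary: xs)
  case 0
  then show ?case by (simp add: pmf_return)
next
  case (Suc n)
  have "replicate_pmf (Suc n) p = map_pmf (\<lambda>(x, xs). x # xs) (pair_pmf p (replicate_pmf n p))"
    by (simp add: pair_pmf_def map_bind_pmf)
  moreover have "inj (\<lambda>(x, xs). x # xs)" by (auto simp: inj_def)
  ultimately have pmf_Cons:
    "pmf (replicate_pmf (Suc n) p) (y # ys) = pmf p y * pmf (replicate_pmf n p) ys" for y ys
    using pmf_map_inj'[of "\<lambda>(x, xs). x # xs" "pair_pmf p (replicate_pmf n p)" "(y, ys)"]
    by (simp add: pmf_pair del: replicate_pmf.simps)
  show ?case
  proof (cases xs)
    case Nil
    then show ?thesis by (simp add: pmf_eq_0_set_pmf)
  next
    case (Cons y ys)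
    then show ?thesis by (simp add: pmf_Cons Suc.IH del: replicate_pmf.simps)
  qed
qed

lemma map_pmf_permute_list_replicate_pmf:
  assumes \<sigma>: "\<sigma> permutes {..<n}"
  shows "map_pmf (permute_list \<sigma>) (replicate_pmf n p) = replicate_pmf n p"
proof (rule pmf_eqI)
  fix xs
  show "pmf (map_pmf (permute_list \<sigma>) (replicate_pmf n p)) xs = pmf (replicate_pmf n p) xs"
  proof (cases "length xs = n")
    case True
    have "permute_list \<sigma> ys = xs \<longleftrightarrow> ys = permute_list (inv \<sigma>) xs" for ys
    proof
      assume "permute_list \<sigma> ys = xs"
      then show "ys = permute_list (inv \<sigma>) xs"
        using permute_list_compose[of "inv \<sigma>" ys \<sigma>] permutes_inv[OF \<sigma>] True permutes_inv_o(1)[OF \<sigma>]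
        by auto
    next
      assume "ys = permute_list (inv \<sigma>) xs"
      then show "permute_list \<sigma> ys = xs"
        using permute_list_compose[of \<sigma> xs "inv \<sigma>"] \<sigma> True permutes_inv_o(2)[OF \<sigma>] by simp
    qed
    then have "permute_list \<sigma> -` {xs} = {permute_list (inv \<sigma>) xs}" by auto
    then show ?thesis
      using True permutes_inv[OF \<sigma>] by (simp add: pmf_map measure_pmf_single pmf_replicate_pmf)
  next
    case False
    then have "xs \<notin> set_pmf (map_pmf (permute_list \<sigma>) (replicate_pmf n p))"
      by (auto simp: set_replicate_pmf)
    moreover have "xs \<notin> set_pmf (replicate_pmf n p)" using False by (simp add: set_replicate_pmf)
    ultimately show ?thesis by (metis pmf_eq_0_set_pmf)
  qed
qed

lemma expectation_replicate_pmf_Suc: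
  fixes f :: "'a list \<Rightarrow> 'b::{banach, second_countable_topology}"
  assumes "finite (set_pmf p)"
  shows "measure_pmf.expectation (replicate_pmf (Suc n) p) f =
    measure_pmf.expectation p (\<lambda>x. measure_pmf.expectation (replicate_pmf n p) (\<lambda>xs. f (x # xs)))"
proof -
  have "replicate_pmf (Suc n) p = bind_pmf p (\<lambda>x. map_pmf ((#) x) (replicate_pmf n p))"
    by (simp add: map_pmf_def)
  then show ?thesis
    using assms
    by (simp only: pmf_expectation_bind[of "set_pmf p"] integral_measure_pmf[of "set_pmf p" p]
        set_map_pmf finite_imageI finite_set_replicate_pmf integral_map_pmf order_refl)
qed

lemma expectation_square_le:
  fixes f :: "'a \<Rightarrow> real"
  assumes "finite (set_pmf P)"
  shows "(measure_pmf.expectation P f)\<^sup>2 \<le> measure_pmf.expectation P (\<lambda>x. (f x)\<^sup>2)"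
  using measure_pmf.variance_positive[of P f] measure_pmf.variance_eq[of P f]
  by (simp add: integrable_measure_pmf_finite[OF assms])

lemma expectation_shifted_square:
  fixes f :: "'a \<Rightarrow> real"
  assumes "finite (set_pmf P)"
  shows "measure_pmf.expectation P (\<lambda>x. (a + f x)\<^sup>2) =
    a\<^sup>2 + 2 * a * measure_pmf.expectation P f + measure_pmf.expectation P (\<lambda>x. (f x)\<^sup>2)"
  by (simp add: power2_sum integrable_measure_pmf_finite[OF assms])

lemma expectation_of_bool_eq: "measure_pmf.expectation p (\<lambda>x. of_bool (x = a)) = pmf p a"
proof -
  have "(\<lambda>x. of_bool (x = a) :: real) = indicator {a}" by (auto simp: fun_eq_iff)
  then show ?thesis by (simp add: measure_pmf_single)
qed

lemma variance_of_bool_eq: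
  assumes "finite (set_pmf p)"
  shows "measure_pmf.expectation p (\<lambda>x. (of_bool (x = a) - pmf p a)\<^sup>2) = pmf p a * (1 - pmf p a)"
  using measure_pmf.variance_eq[of p "\<lambda>x. of_bool (x = a)"]
  by (simp add: integrable_measure_pmf_finite[OF assms] expectation_of_bool_eq power2_eq_square
      right_diff_distrib flip: of_bool_conj)

lemma variance_count_list_replicate_pmf:
  assumes p: "finite (set_pmf p)"
  shows "measure_pmf.expectation (replicate_pmf n p) (\<lambda>xs. (real (count_list xs a) - n * pmf p a)\<^sup>2) =
    n * (pmf p a * (1 - pmf p a))"
proof (induction n)
  case 0
  then show ?case by simp
next
  case (Suc n)
  let ?E = "measure_pmf.expectation"
  note integrable = integrable_measure_pmf_finite[OF p]
  define d where "d x = of_bool (x = a) - pmf p a" for x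
  define X where "X xs = real (count_list xs a) - n * pmf p a" for xs
  have mean_d: "?E p d = 0"
    unfolding d_def by (simp add: integrable expectation_of_bool_eq)
  have "real (count_list (x # xs) a) - Suc n * pmf p a = d x + X xs" for x xs
    by (simp add: d_def X_def algebra_simps)
  then have "?E (replicate_pmf (Suc n) p) (\<lambda>xs. (real (count_list xs a) - Suc n * pmf p a)\<^sup>2) =
      ?E p (\<lambda>x. ?E (replicate_pmf n p) (\<lambda>xs. (d x + X xs)\<^sup>2))"
    by (simp only: expectation_replicate_pmf_Suc[OF p])
  also have "\<dots> = ?E p (\<lambda>x. (d x)\<^sup>2 + 2 * d x * ?E (replicate_pmf n p) X +
      ?E (replicate_pmf n p) (\<lambda>xs. (X xs)\<^sup>2))"
    by (simp only: expectation_shifted_square finite_set_replicate_pmf p)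
  also have "\<dots> = ?E p (\<lambda>x. (d x)\<^sup>2) + ?E (replicate_pmf n p) (\<lambda>xs. (X xs)\<^sup>2)"
    by (simp add: integrable mean_d)
  also have "\<dots> = pmf p a * (1 - pmf p a) + n * (pmf p a * (1 - pmf p a))"
    by (simp only: d_def X_def variance_of_bool_eq[OF p] Suc.IH)
  finally show ?case by (simp add: algebra_simps)
qed

lemma expectation_replicate_pmf_ge_drift:
  fixes F :: "'a list \<Rightarrow> real"
  assumes p: "finite (set_pmf p)"
    and drift: "\<And>xs. set xs \<subseteq> set_pmf p \<Longrightarrow> F xs + c \<le> measure_pmf.expectation p (\<lambda>x. F (xs @ [x]))"
  shows "F [] + n * c \<le> measure_pmf.expectation (replicate_pmf n p) F"
  using drift
proof (induction n arbitrary: F)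
  case 0
  then show ?case by simp
next
  case (Suc n)
  have "F [] + Suc n * c \<le> measure_pmf.expectation p (\<lambda>x. F [x]) + n * c"
    using Suc.prems[of "[]"] by (simp add: algebra_simps)
  also have "\<dots> = measure_pmf.expectation p (\<lambda>x. F [x] + n * c)"
    by (simp add: integrable_measure_pmf_finite[OF p])
  also have "\<dots> \<le> measure_pmf.expectation p
      (\<lambda>x. measure_pmf.expectation (replicate_pmf n p) (\<lambda>xs. F (x # xs)))"
  proof (intro integral_mono_AE integrable_measure_pmf_finite[OF p] AE_pmfI)
    fix x assume "x \<in> set_pmf p"
    then show "F [x] + n * c \<le> measure_pmf.expectation (replicate_pmf n p) (\<lambda>xs. F (x # xs))"
      using Suc.IH[of "\<lambda>xs. F (x # xs)"] Suc.prems[of "x # _"] by simp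
  qed
  finally show ?case by (simp only: expectation_replicate_pmf_Suc[OF p])
qed

lemma pmf_of_multiset_mset:
  assumes "xs \<noteq> []"
  shows "pmf_of_multiset (mset xs) = map_pmf ((!) xs) (pmf_of_set {..<length xs})"
proof -
  have "image_mset ((!) xs) (mset_set {..<length xs}) = mset xs"
    by (simp add: map_nth flip: mset_map mset_upt atLeast0LessThan)
  then show ?thesis using assms by (subst map_pmf_of_set) auto
qed

lemma expectation_pmf_of_multiset_mset:
  fixes f :: "'a \<Rightarrow> real"
  assumes "xs \<noteq> []"
  shows "measure_pmf.expectation (pmf_of_multiset (mset xs)) f = (\<Sum>x\<leftarrow>xs. f x) / length xs"
  using assms
  by (simp add: pmf_of_multiset_mset integral_pmf_of_set lessThan_empty_iff sum_list_sum_nth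
      atLeast0LessThan)

lemma pmf_of_multiset_mset_map:
  assumes "xs \<noteq> []"
  shows "pmf_of_multiset (mset (map f xs)) = map_pmf f (pmf_of_multiset (mset xs))"
  using assms
  by (auto simp: pmf_of_multiset_mset map_pmf_comp lessThan_empty_iff simp del: mset_map
      intro!: map_pmf_cong)

section \<open>Random order and independent items\<close>

lemma expectation_random_order_cost_iid:
  assumes p: "finite (set_pmf p)"
  shows "measure_pmf.expectation (replicate_pmf n p) (random_order_cost A) =
    measure_pmf.expectation (replicate_pmf n p) (\<lambda>I. real (A I))"
proof -
  define perms where "perms = {\<sigma>. \<sigma> permutes {..<n}}"
  have perms: "finite perms" "perms \<noteq> {}"
    unfolding perms_def using permutes_id[of "{..<n}"] by (blast intro: finite_permutations)+
  have "measure_pmf.expectation (replicate_pmf n p) (random_order_cost A) =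
      measure_pmf.expectation (replicate_pmf n p)
        (\<lambda>I. (\<Sum>\<sigma>\<in>perms. real (A (permute_list \<sigma> I))) / card perms)"
    using perms by (intro integral_cong_AE AE_pmfI)
      (auto simp: random_order_cost_def set_replicate_pmf integral_pmf_of_set simp flip: perms_def)
  also have "\<dots> = (\<Sum>\<sigma>\<in>perms. measure_pmf.expectation (replicate_pmf n p)
      (\<lambda>I. real (A (permute_list \<sigma> I)))) / card perms"
    by (simp add: integrable_measure_pmf_finite finite_set_replicate_pmf[OF p])
  also have "measure_pmf.expectation (replicate_pmf n p) (\<lambda>I. real (A (permute_list \<sigma> I))) =
      measure_pmf.expectation (replicate_pmf n p) (\<lambda>I. real (A I))" if "\<sigma> \<in> perms" for \<sigma>
    using that integral_map_pmf[of "permute_list \<sigma>" "replicate_pmf n p" "\<lambda>I. real (A I)"]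
    by (simp add: perms_def map_pmf_permute_list_replicate_pmf)
  then have "(\<Sum>\<sigma>\<in>perms. measure_pmf.expectation (replicate_pmf n p)
      (\<lambda>I. real (A (permute_list \<sigma> I)))) / card perms =
      measure_pmf.expectation (replicate_pmf n p) (\<lambda>I. real (A I))"
    using perms by simp
  finally show ?thesis .
qed

lemma expectation_quotient_le:
  fixes f g :: "'a \<Rightarrow> real" and u :: ereal
  assumes P: "finite (set_pmf P)" and g: "\<And>x. x \<in> set_pmf P \<Longrightarrow> g x > 0"
    and le: "\<And>x. x \<in> set_pmf P \<Longrightarrow> ereal (f x / g x) \<le> u"
  shows "ereal (measure_pmf.expectation P f / measure_pmf.expectation P g) \<le> u"
proof (cases u)
  case (real r)
  note integrable = integrable_measure_pmf_finite[OF P]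
  have "f x \<le> r * g x" if "x \<in> set_pmf P" for x
    using g[OF that] le[OF that] real by (simp add: pos_divide_le_eq)
  then have "measure_pmf.expectation P f \<le> measure_pmf.expectation P (\<lambda>x. r * g x)"
    by (intro integral_mono_AE integrable AE_pmfI)
  moreover have "measure_pmf.expectation P g > 0"
    by (intro measure_pmf.expectation_greater integrable AE_pmfI g)
  ultimately show ?thesis using real by (simp add: pos_divide_le_eq)
next
  case MInf
  then show ?thesis using le set_pmf_not_empty[of P] by auto
qed simp

lemma bp_opt_le: "is_packing I k f \<Longrightarrow> bp_opt I \<le> k"
  unfolding bp_opt_def by (rule Least_le) blast

lemma bp_opt_packing:
  assumes "bp_instance I"
  obtains f where "is_packing I (bp_opt I) f"
proof -
  have "{i. i < length I \<and> i = b} = {b}" if "b < length I" for b using that by auto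
  then have "is_packing I (length I) (\<lambda>i. i)"
    using assms by (auto simp: is_packing_def bp_instance_def)
  then have "\<exists>f. is_packing I (bp_opt I) f"
    unfolding bp_opt_def using LeastI_ex[of "\<lambda>k. \<exists>f. is_packing I k f"] by blast
  then show thesis using that by blast
qed

lemma sum_list_le_bp_opt:
  assumes "bp_instance I"
  shows "sum_list I \<le> real (bp_opt I)"
proof -
  obtain f where f: "is_packing I (bp_opt I) f" using assms by (rule bp_opt_packing)
  have "sum_list I = (\<Sum>i<length I. I ! i)" by (simp add: sum_list_sum_nth atLeast0LessThan)
  also have "\<dots> = (\<Sum>b<bp_opt I. \<Sum>i | i \<in> {..<length I} \<and> f i = b. I ! i)"
    using f by (intro sum.group[symmetric]) (auto simp: is_packing_def)
  also have "\<dots> \<le> (\<Sum>b<bp_opt I. 1)"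
    using f by (intro sum_mono) (auto simp: is_packing_def)
  finally show ?thesis by simp
qed

lemma eventually_bp_opt_iid_ge:
  assumes p: "finite (set_pmf p)" "set_pmf p \<subseteq> {0<..1}"
  shows "\<forall>\<^sub>F n in sequentially. \<forall>I\<in>set_pmf (replicate_pmf n p). bp_instance I \<and> m \<le> bp_opt I"
proof -
  define \<delta> where "\<delta> = Min (set_pmf p)"
  have \<delta>: "\<delta> > 0" "\<And>x. x \<in> set_pmf p \<Longrightarrow> \<delta> \<le> x"
    using p Min_in[OF p(1) set_pmf_not_empty] by (auto simp: \<delta>_def)
  have "filterlim (\<lambda>n. \<delta> * real n) at_top sequentially"
    using \<delta>(1) filterlim_real_sequentially by (intro filterlim_tendsto_pos_mult_at_top) auto
  then have "\<forall>\<^sub>F n in sequentially. real m \<le> \<delta> * real n"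
    by (simp add: filterlim_at_top)
  then show ?thesis
  proof eventually_elim
    case (elim n)
    have "bp_instance I \<and> m \<le> bp_opt I" if I: "I \<in> set_pmf (replicate_pmf n p)" for I
    proof
      show inst: "bp_instance I"
        using I p(2) by (auto simp: bp_instance_def set_replicate_pmf)
      have "\<delta> * real n = (\<Sum>x\<leftarrow>I. \<delta>)" using I by (simp add: set_replicate_pmf sum_list_triv)
      also have "\<dots> \<le> (\<Sum>x\<leftarrow>I. x)" using I by (intro sum_list_mono \<delta>(2)) (auto simp: set_replicate_pmf)
      also have "\<dots> \<le> real (bp_opt I)" using sum_list_le_bp_opt[OF inst] by simp
      finally show "m \<le> bp_opt I" using elim by simp
    qed
    then show ?case by blast
  qed
qed

theorem random_order_ratio_ge_iid:
  assumes p: "finite (set_pmf p)" "set_pmf p \<subseteq> {0<..1}"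
  shows "limsup (\<lambda>n. ereal (measure_pmf.expectation (replicate_pmf n p) (\<lambda>I. real (A I)) /
      measure_pmf.expectation (replicate_pmf n p) (\<lambda>I. real (bp_opt I)))) \<le> random_order_ratio A"
    (is "limsup ?quotient \<le> _")
proof -
  define worst where
    "worst m = (SUP I \<in> {I. bp_instance I \<and> bp_opt I = m}.
      ereal (random_order_cost A I / real (bp_opt I)))" for m
  have "limsup ?quotient \<le> (SUP m\<in>{k..}. worst m)" for k
  proof (rule Limsup_bounded)
    show "\<forall>\<^sub>F n in sequentially. ?quotient n \<le> (SUP m\<in>{k..}. worst m)"
      using eventually_bp_opt_iid_ge[OF p, of "Suc k"]
    proof eventually_elim
      case (elim n)
      show ?case
        unfolding expectation_random_order_cost_iid[OF p(1), of n A, symmetric]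
      proof (rule expectation_quotient_le[OF finite_set_replicate_pmf[OF p(1)]])
        fix I assume "I \<in> set_pmf (replicate_pmf n p)"
        with elim have I: "bp_instance I" "Suc k \<le> bp_opt I" by auto
        then show "0 < real (bp_opt I)" by simp
        have "ereal (random_order_cost A I / real (bp_opt I)) \<le> worst (bp_opt I)"
          unfolding worst_def using I by (intro SUP_upper) simp
        also have "\<dots> \<le> (SUP m\<in>{k..}. worst m)" using I by (intro SUP_upper) simp
        finally show "ereal (random_order_cost A I / real (bp_opt I)) \<le> (SUP m\<in>{k..}. worst m)" .
      qed
    qed
  qed
  then show ?thesis
    unfolding random_order_ratio_def worst_def[symmetric] limsup_INF_SUP[of worst]
    by (rule INF_greatest)
qed

section \<open>Repeating a template\<close>

definition occurrence :: "'a list \<Rightarrow> nat \<Rightarrow> nat" where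
  "occurrence xs k = count_list (take k xs) (xs ! k)"

lemma occurrence_less:
  assumes "k < k'" "k' \<le> length xs"
  shows "occurrence xs k < count_list (take k' xs) (xs ! k)"
proof -
  have "take k' xs = take k xs @ xs ! k # drop (Suc k) (take k' xs)"
    using id_take_nth_drop[of k "take k' xs"] assms by (simp add: min_def)
  from arg_cong[OF this, of "\<lambda>ys. count_list ys (xs ! k)"] show ?thesis by (simp add: occurrence_def)
qed

lemma inj_on_nth_occurrence: "inj_on (\<lambda>k. (xs ! k, occurrence xs k)) {..<length xs}"
proof (rule linorder_inj_onI')
  fix k k' assume "k \<in> {..<length xs}" "k' \<in> {..<length xs}" "k < k'"
  then show "(xs ! k, occurrence xs k) \<noteq> (xs ! k', occurrence xs k')"
    using occurrence_less[of k k' xs] by (auto simp: occurrence_def)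
qed

text \<open>The \<open>j\<close>-th occurrences of all the labels together form a subset of one copy of the template.\<close>

lemma bp_opt_map_nth_le:
  assumes T: "bp_instance T" and g: "is_packing T Q g"
    and ls: "set ls \<subseteq> {..<length T}" and M: "\<And>i. i < length T \<Longrightarrow> count_list ls i \<le> M"
  shows "bp_opt (map ((!) T) ls) \<le> Q * M"
proof (rule bp_opt_le)
  define f where "f k = occurrence ls k * Q + g (ls ! k)" for k
  have label: "ls ! k < length T" if "k < length ls" for k using ls nth_mem[OF that] by auto
  have g_less: "g (ls ! k) < Q" if "k < length ls" for k
    using g label[OF that] by (simp add: is_packing_def)
  show "is_packing (map ((!) T) ls) (Q * M) f"
    unfolding is_packing_def length_map
  proof (intro conjI allI impI)
    fix k assume k: "k < length ls"
    have "occurrence ls k < M"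
      using occurrence_less[of k "length ls" ls] k M[OF label[OF k]] by simp
    then have "Suc (occurrence ls k) * Q \<le> M * Q" by (intro mult_le_mono1) simp
    then show "f k < Q * M" using g_less[OF k] by (simp add: f_def mult.commute)
  next
    fix b assume b: "b < Q * M"
    let ?K = "{k. k < length ls \<and> f k = b}"
    have rank: "occurrence ls k = b div Q" and bin: "g (ls ! k) = b mod Q" if "k \<in> ?K" for k
      using that g_less[of k] by (auto simp: f_def)
    have "inj_on ((!) ls) ?K"
      using inj_on_nth_occurrence[of ls] rank by (auto simp: inj_on_def)
    then have "(\<Sum>k\<in>?K. map ((!) T) ls ! k) = (\<Sum>i\<in>(!) ls ` ?K. T ! i)"
      by (simp add: sum.reindex)
    also have "\<dots> \<le> (\<Sum>i | i < length T \<and> g i = b mod Q. T ! i)"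
      using T label bin by (intro sum_mono2) (auto simp: bp_instance_def intro: less_imp_le)
    also have "\<dots> \<le> 1"
      using g b by (cases Q) (auto simp: is_packing_def)
    finally show "(\<Sum>k\<in>?K. map ((!) T) ls ! k) \<le> 1" .
  qed
qed

lemma bp_opt_map_nth_le_L2_set:
  assumes T: "bp_instance T" "T \<noteq> []" and g: "is_packing T Q g" and ls: "set ls \<subseteq> {..<length T}"
  shows "real (bp_opt (map ((!) T) ls)) \<le>
    real Q * (c + L2_set (\<lambda>i. real (count_list ls i) - c) {..<length T})"
proof -
  define M where "M = Max (count_list ls ` {..<length T})"
  have "M \<in> count_list ls ` {..<length T}" unfolding M_def using T(2) by (intro Max_in) auto
  then obtain i where i: "i < length T" "M = count_list ls i" by auto
  have "count_list ls j \<le> M" if "j < length T" for j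
    unfolding M_def using that by (intro Max_ge) auto
  then have "bp_opt (map ((!) T) ls) \<le> Q * M" by (rule bp_opt_map_nth_le[OF T(1) g ls])
  then have "real (bp_opt (map ((!) T) ls)) \<le> real Q * real M" by (simp flip: of_nat_mult)
  also have "real M - c \<le> L2_set (\<lambda>i. real (count_list ls i) - c) {..<length T}"
    unfolding i(2) using i(1) by (intro member_le_L2_set) auto
  then have "real Q * real M \<le> real Q * (c + L2_set (\<lambda>i. real (count_list ls i) - c) {..<length T})"
    by (intro mult_left_mono) auto
  finally show ?thesis .
qed

lemma expectation_L2_set_count_list_le:
  assumes p: "finite (set_pmf p)"
  shows "measure_pmf.expectation (replicate_pmf n p)
    (\<lambda>xs. L2_set (\<lambda>a. real (count_list xs a) - n * pmf p a) (set_pmf p)) \<le> sqrt n"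
proof (rule real_le_rsqrt)
  let ?dev = "\<lambda>xs a. real (count_list xs a) - n * pmf p a"
  note finite = finite_set_replicate_pmf[OF p]
  have "(measure_pmf.expectation (replicate_pmf n p) (\<lambda>xs. L2_set (?dev xs) (set_pmf p)))\<^sup>2 \<le>
      measure_pmf.expectation (replicate_pmf n p) (\<lambda>xs. (L2_set (?dev xs) (set_pmf p))\<^sup>2)"
    by (rule expectation_square_le[OF finite])
  also have "\<dots> = (\<Sum>a\<in>set_pmf p. n * (pmf p a * (1 - pmf p a)))"
    by (simp add: L2_set_def sum_nonneg integrable_measure_pmf_finite[OF finite]
        variance_count_list_replicate_pmf[OF p])
  also have "\<dots> \<le> (\<Sum>a\<in>set_pmf p. n * pmf p a)"
    by (intro sum_mono mult_left_mono) (simp_all add: mult_left_le)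
  also have "\<dots> = n"
    using p by (simp add: sum_pmf_eq_1 flip: sum_distrib_left)
  finally show
    "(measure_pmf.expectation (replicate_pmf n p) (\<lambda>xs. L2_set (?dev xs) (set_pmf p)))\<^sup>2 \<le> n" .
qed

lemma expectation_bp_opt_template_le:
  assumes T: "bp_instance T" "T \<noteq> []" and g: "is_packing T Q g"
  shows "measure_pmf.expectation (replicate_pmf n (pmf_of_multiset (mset T))) (\<lambda>I. real (bp_opt I)) \<le>
    real Q * (n / length T + sqrt n)"
proof -
  define p where "p = pmf_of_set {..<length T}"
  have set_p: "set_pmf p = {..<length T}" using T(2) by (simp add: p_def lessThan_empty_iff)
  then have finite: "finite (set_pmf p)" by simp
  note integrable = integrable_measure_pmf_finite[OF finite_set_replicate_pmf[OF finite]]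
  define dev where "dev ls = L2_set (\<lambda>i. real (count_list ls i) - n / length T) {..<length T}" for ls
  have mean_dev: "measure_pmf.expectation (replicate_pmf n p) dev \<le> sqrt n"
  proof -
    have "dev = (\<lambda>ls. L2_set (\<lambda>i. real (count_list ls i) - n * pmf p i) (set_pmf p))"
      unfolding dev_def set_p using T(2)
      by (intro ext L2_set_cong) (auto simp: p_def lessThan_empty_iff)
    then show ?thesis using expectation_L2_set_count_list_le[OF finite, of n] by simp
  qed
  have "measure_pmf.expectation (replicate_pmf n (pmf_of_multiset (mset T))) (\<lambda>I. real (bp_opt I)) =
      measure_pmf.expectation (replicate_pmf n p) (\<lambda>ls. real (bp_opt (map ((!) T) ls)))"
    using T(2) by (simp add: pmf_of_multiset_mset map_replicate_pmf p_def)
  also have "\<dots> \<le> measure_pmf.expectation (replicate_pmf n p) (\<lambda>ls. real Q * (n / length T + dev ls))"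
  proof (intro integral_mono_AE integrable AE_pmfI)
    fix ls assume "ls \<in> set_pmf (replicate_pmf n p)"
    then have "set ls \<subseteq> {..<length T}" by (auto simp: set_replicate_pmf set_p)
    then show "real (bp_opt (map ((!) T) ls)) \<le> real Q * (n / length T + dev ls)"
      unfolding dev_def by (rule bp_opt_map_nth_le_L2_set[OF T g])
  qed
  also have "\<dots> = real Q * (n / length T + measure_pmf.expectation (replicate_pmf n p) dev)"
    by (simp add: integrable)
  also have "\<dots> \<le> real Q * (n / length T + sqrt n)"
    using mean_dev by (intro mult_left_mono) auto
  finally show ?thesis .
qed

lemma tendsto_affine_over_linear_sqrt:
  fixes a c d w :: real
  assumes "a > 0" "w > 0"
  shows "(\<lambda>n. (c * real n - d) / (a * (n / w + sqrt n))) \<longlonglongrightarrow> c * w / a"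
proof (rule Lim_transform_eventually)
  have "(\<lambda>n. sqrt (real n) / n) \<longlonglongrightarrow> 0"
    using tendsto_real_sqrt[OF lim_1_over_n]
    by (simp add: real_sqrt_divide sqrt_divide_self_eq inverse_eq_divide)
  then have "(\<lambda>n. (c - d / real n) / (a * (1 / w + sqrt n / n))) \<longlonglongrightarrow> (c - 0) / (a * (1 / w + 0))"
    using assms by (intro tendsto_intros lim_const_over_n) auto
  then show "(\<lambda>n. (c - d / real n) / (a * (1 / w + sqrt n / n))) \<longlonglongrightarrow> c * w / a" by simp
  show "\<forall>\<^sub>F n in sequentially.
      (c - d / real n) / (a * (1 / w + sqrt n / n)) = (c * n - d) / (a * (n / w + sqrt n))"
    using eventually_gt_at_top[of 0]
  proof eventually_elim
    case (elim n)
    then show ?case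
      using mult_divide_mult_cancel_left[of "real n" "c - d / n" "a * (1 / w + sqrt n / n)"]
      by (simp add: algebra_simps)
  qed
qed

theorem random_order_ratio_ge_template:
  assumes T: "bp_instance T" "T \<noteq> []" and g: "is_packing T Q g"
    and A: "\<And>n. c * real n - d \<le>
      measure_pmf.expectation (replicate_pmf n (pmf_of_multiset (mset T))) (\<lambda>I. real (A I))"
  shows "ereal (c * length T / Q) \<le> random_order_ratio A"
proof -
  define p where "p = pmf_of_multiset (mset T)"
  let ?E = "\<lambda>n f. measure_pmf.expectation (replicate_pmf n p) (\<lambda>I. real (f I))"
  define bound where "bound n = (c * real n - d) / (Q * (n / length T + sqrt n))" for n
  have p: "finite (set_pmf p)" "set_pmf p \<subseteq> {0<..1}"
    using T by (auto simp: p_def bp_instance_def)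
  have "Q > 0" using T(2) g by (auto simp: is_packing_def)
  then have lim: "bound \<longlonglongrightarrow> c * length T / Q"
    unfolding bound_def using T(2) by (intro tendsto_affine_over_linear_sqrt) auto
  have "\<forall>\<^sub>F n in sequentially. ereal (bound n) \<le> ereal (?E n A / ?E n bp_opt)"
    using eventually_bp_opt_iid_ge[OF p, of 1]
  proof eventually_elim
    case (elim n)
    have "?E n bp_opt > 0"
      using elim by (intro measure_pmf.expectation_greater AE_pmfI)
        (auto simp: integrable_measure_pmf_finite[OF finite_set_replicate_pmf[OF p(1)]])
    then have "bound n \<le> ?E n A / ?E n bp_opt"
      unfolding bound_def using A[of n] expectation_bp_opt_template_le[OF T g, of n]
      by (intro frac_le) (auto simp: p_def)
    then show ?case by simp
  qed
  then have "limsup (\<lambda>n. ereal (bound n)) \<le> limsup (\<lambda>n. ereal (?E n A / ?E n bp_opt))"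
    by (rule Limsup_mono)
  also have "\<dots> \<le> random_order_ratio A"
    by (rule random_order_ratio_ge_iid[OF p])
  finally show ?thesis
    using lim_imp_Limsup[OF sequentially_bot tendsto_ereal[OF lim]] by simp
qed

section \<open>Potentials and the random-order ratio of Best-Fit\<close>

lemma expectation_best_fit_ge_potential:
  fixes h :: "int list \<Rightarrow> real" and c :: real
  assumes C: "C > 0" and T: "T \<noteq> []" "\<And>x. x \<in> set T \<Longrightarrow> k \<le> x"
    and K: "[] \<in> K" "\<And>s x. s \<in> K \<Longrightarrow> x \<in> set T \<Longrightarrow> next_state C k x s \<in> K"
    and h: "\<And>s. s \<in> K \<Longrightarrow> h s \<le> b"
    and drift: "\<And>s. s \<in> K \<Longrightarrow>
      length T * (h s + c) \<le> (\<Sum>x\<leftarrow>T. h (next_state C k x s) + of_bool (opens_bin C x s))"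
  shows "c * real n - (b - h []) \<le>
    measure_pmf.expectation (replicate_pmf n (pmf_of_multiset (mset T)))
      (\<lambda>xs. real (best_fit (map (rel_size C) xs)))"
proof -
  define p where "p = pmf_of_multiset (mset T)"
  have p: "finite (set_pmf p)" "set_pmf p = set T" using T(1) by (simp_all add: p_def)
  define bins where "bins xs = fold best_fit_step (map (rel_size C) xs) {#}" for xs
  define state where "state xs = fold (next_state C k) xs []" for xs
  define F where "F xs = real (size (bins xs)) + h (state xs)" for xs
  have state_in: "state xs \<in> K" if "set xs \<subseteq> set T" for xs
    unfolding state_def
    by (rule fold_invariant[where P = "\<lambda>s. s \<in> K" and Q = "\<lambda>x. x \<in> set T"]) (use that K in auto)
  have "F xs + c \<le> measure_pmf.expectation p (\<lambda>x. F (xs @ [x]))" if xs: "set xs \<subseteq> set_pmf p" for xs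
  proof -
    define gain where
      "gain x = h (next_state C k x (state xs)) + of_bool (opens_bin C x (state xs))" for x
    have "represents C k (state xs) (bins xs)"
      unfolding state_def bins_def using xs T(2) by (intro represents_fold C) (auto simp: p(2))
    then have "F (xs @ [x]) = real (size (bins xs)) + gain x" if "x \<in> set T" for x
      using size_best_fit_step_represents[OF C T(2)[OF that]]
      by (simp add: F_def bins_def state_def gain_def)
    then have "(\<Sum>x\<leftarrow>T. F (xs @ [x])) = length T * real (size (bins xs)) + (\<Sum>x\<leftarrow>T. gain x)"
      by (simp add: sum_list_addf sum_list_triv cong: map_cong)
    moreover have "length T * (h (state xs) + c) \<le> (\<Sum>x\<leftarrow>T. gain x)"
      unfolding gain_def using drift[OF state_in] xs by (simp add: p(2))
    ultimately show ?thesis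
      using T(1) by (simp add: p_def F_def expectation_pmf_of_multiset_mset field_simps)
  qed
  then have "F [] + n * c \<le> measure_pmf.expectation (replicate_pmf n p) F"
    by (rule expectation_replicate_pmf_ge_drift[OF p(1)])
  also have "\<dots> \<le>
      measure_pmf.expectation (replicate_pmf n p) (\<lambda>xs. real (size (bins xs)) + b)"
    using h state_in
    by (intro integral_mono_AE integrable_measure_pmf_finite finite_set_replicate_pmf p(1) AE_pmfI)
      (auto simp: F_def set_replicate_pmf p(2))
  also have "\<dots> =
      measure_pmf.expectation (replicate_pmf n p) (\<lambda>xs. real (size (bins xs))) + b"
    by (simp add: integrable_measure_pmf_finite finite_set_replicate_pmf p(1))
  finally show ?thesis
    by (simp add: p_def F_def bins_def state_def best_fit_def algebra_simps)
qed

theorem random_order_ratio_best_fit_ge_potential: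
  fixes h :: "int list \<Rightarrow> real" and c :: real
  assumes k: "k > 0" and T: "T \<noteq> []" "\<And>x. x \<in> set T \<Longrightarrow> k \<le> x \<and> x \<le> C"
    and packing: "is_packing (map (rel_size C) T) Q g"
    and K: "[] \<in> K" "\<And>s x. s \<in> K \<Longrightarrow> x \<in> set T \<Longrightarrow> next_state C k x s \<in> K"
    and h: "\<And>s. s \<in> K \<Longrightarrow> h s \<le> b"
    and drift: "\<And>s. s \<in> K \<Longrightarrow>
      length T * (h s + c) \<le> (\<Sum>x\<leftarrow>T. h (next_state C k x s) + of_bool (opens_bin C x s))"
  shows "ereal (c * length T / Q) \<le> random_order_ratio best_fit"
proof -
  let ?items = "map (rel_size C) T"
  have C: "C > 0" using k T by (cases T) fastforce+
  have "bp_instance ?items"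
    using k T(2) C by (fastforce simp: bp_instance_def rel_size_def)
  moreover have "c * real n - (b - h []) \<le>
      measure_pmf.expectation (replicate_pmf n (pmf_of_multiset (mset ?items)))
        (\<lambda>I. real (best_fit I))" for n
    using expectation_best_fit_ge_potential[OF C T(1) _ K h drift, of n] T
    by (simp add: pmf_of_multiset_mset_map map_replicate_pmf del: mset_map)
  ultimately show ?thesis
    using random_order_ratio_ge_template[OF _ _ packing, of c "b - h []" best_fit] T(1)
    by simp
qed

theorem random_order_ratio_best_fit_ge_rounded_potential:
  fixes h :: "int list \<Rightarrow> real" and c :: real
  assumes k: "k > 0" and T: "T \<noteq> []" "\<And>x. x \<in> set T \<Longrightarrow> k \<le> x \<and> x \<le> C"
    and packing: "is_packing (map (rel_size C) T) Q g"
    and r: "\<And>x. x \<in> set T \<Longrightarrow> load_rounding C k x r"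
    and K: "finite K" "[] \<in> K" "\<And>s x. s \<in> K \<Longrightarrow> x \<in> set T \<Longrightarrow> map r (next_state C k x s) \<in> K"
    and drift: "\<And>s. s \<in> K \<Longrightarrow>
      length T * (h s + c) \<le> (\<Sum>x\<leftarrow>T. h (map r (next_state C k x s)) + of_bool (opens_bin C x s))"
  shows "ereal (c * length T / Q) \<le> random_order_ratio best_fit"
proof (rule random_order_ratio_best_fit_ge_potential
    [where K = "{s. map r s \<in> K}" and h = "\<lambda>s. h (map r s)" and b = "Max (h ` K)"])
  note next_rounded = map_next_state_load_rounding[OF r]
  show "next_state C k x s \<in> {s. map r s \<in> K}" if "s \<in> {s. map r s \<in> K}" "x \<in> set T" for s x
    using K(3)[of "map r s" x] next_rounded[of x s] that by simp
  show "length T * (h (map r s) + c) \<le>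
      (\<Sum>x\<leftarrow>T. h (map r (next_state C k x s)) + of_bool (opens_bin C x s))"
    if "s \<in> {s. map r s \<in> K}" for s
    using drift[of "map r s"] that
    by (simp add: next_rounded opens_bin_load_rounding[OF r] cong: map_cong)
qed (use k T packing K(1,2) in auto)

theorem theorem1p2:
  shows "random_order_ratio best_fit > ereal 1.144"
proof -
  have "ereal (4027 / 11440 * length template / (4::nat)) \<le> random_order_ratio best_fit"
  proof (rule random_order_ratio_best_fit_ge_rounded_potential
      [where k = 30 and C = 120 and r = raise_load and K = "dom (map_of potential_table)"
        and h = "\<lambda>s. potential s / 4400"])
    show "is_packing (map (rel_size 120) template) 4
        (\<lambda>i. if i < 4 then 0 else Suc ((i - 4) div 3))"
      by (rule template_packing)
    show "template \<noteq> []" by (simp add: template_def)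
    show "30 \<le> x \<and> x \<le> 120" if "x \<in> set template" for x
      using that by (auto simp: template_def)
  qed (simp_all add: load_rounding_raise_load finite_dom_map_of Nil_in_potential_table
      raised_next_state_in_potential_table potential_drift)
  moreover have "ereal 1.144 < ereal (4027 / 11440 * length template / (4::nat))"
    by (simp add: template_def)
  ultimately show ?thesis by (rule less_le_trans[rotated])
qed

end
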